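(* Let $D(i)=i$ be the identity function on $\mathbb{N}$. There exists an eventually consistent generator $\mathcal{A}$ such that $\mu_{up}(\mathcal{A},D)=1/2$.
   Context: Game. Fix a countably infinite universe $U=(u_1,u_2,\dots)$ with a fixed bijective enumeration. A language is an infinite subset of $U$; its elements are listed in the order inherited from $U$, $K=(k_1,k_2,\dots)$, and $K_i=\{k_1,\dots,k_i\}$. A collection is a countable collection $\mathcal{L}=(L^1,L^2,\dots)$ of languages with a fixed enumeration. $\mathcal{E}(K)$ is the set of all enumerations $E=(e_1,e_2,\dots)$ of $K$, i.e. surjections $\mathbb{N}\to K$ (repetitions allowed). A generator $\mathcal{A}$ knows $U$ and $\mathcal{L}$ and is given by maps $\mathcal{A}_t:U^t\to U$, $t\ge1$ (which may depend on $\mathcal{L}$); on $E$ it outputs $o_t=\mathcal{A}_t(e_1,\dots,e_t)$, where $o_t$ must differ from all of $o_1,\dots,o_{t-1}$ and $e_1,\dots,e_t$. Write $\mathcal{A}(E)=(o_1,o_2,\dots)$. Eventual consistency. $\mathcal{A}$ is eventually consistent if for every collection $\mathcal{L}$, every $K\in\mathcal{L}$ and every $E\in\mathcal{E}(K)$ there is a finite $T$ (depending on $\mathcal{L},K,E$) such that $o_t\in K$ for all $t\ge T$. Density. For sequences $S=(s_1,s_2,\dots)$, $R=(r_1,r_2,\dots)$, put $S_n=\{s_1,\dots,s_n\}$ and, for $D:\mathbb{N}\to\mathbb{N}$, $$\mu_i(S,R,D)=\frac1i\sum_{j=1}^i \mathbf{1}\{r_j\in S_{D(j)}\}.$$ The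 upper density is $\mu_{up}(\mathcal{A},D)=\inf_{\mathcal{L}}\inf_{K\in\mathcal{L}}\inf_{E\in\mathcal{E}(K)}\limsup_{i\to\infty}\mu_i(\mathcal{A}(E),K,D)$, with $\mathcal{L}$ ranging over all countable language collections. *)

theory Defs
  imports "HOL-Library.Infinite_Set" "HOL-Library.Extended_Real"
begin

text \<open>
  All sequences are functions on \<open>nat\<close> read from index 0, so that \<open>s i\<close> is the
  mathematical \<open>s\<^sub>i\<^sub>+\<^sub>1\<close>. The universe is a type \<open>'a\<close> together with a bijective enumeration
  \<open>u :: nat \<Rightarrow> 'a\<close>.
\<close>

definition language :: "'a set \<Rightarrow> bool" where
  "language K \<longleftrightarrow> infinite K"

text \<open>
  A collection is an enumerated sequence of languages; repetitions are allowed, so finite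
  collections are included.
\<close>

definition collection :: "(nat \<Rightarrow> 'a set) \<Rightarrow> bool" where
  "collection L \<longleftrightarrow> (\<forall>n. language (L n))"

definition listing :: "(nat \<Rightarrow> 'a) \<Rightarrow> 'a set \<Rightarrow> nat \<Rightarrow> 'a" where
  "listing u K i = u (enumerate (u -` K) i)"

definition enumerations :: "'a set \<Rightarrow> (nat \<Rightarrow> 'a) set" where
  "enumerations K = {E. range E = K}"

text \<open>
  The maps \<open>U\<^sup>t \<rightarrow> U\<close>, for all \<open>t\<close>, are bundled into one function on lists, depending on the
  enumerated collection; only nonempty lists are ever used.
\<close>

type_synonym 'a gen = "(nat \<Rightarrow> 'a set) \<Rightarrow> 'a list \<Rightarrow> 'a"

definition outputs :: "'a gen \<Rightarrow> (nat \<Rightarrow> 'a set) \<Rightarrow> (nat \<Rightarrow> 'a) \<Rightarrow> nat \<Rightarrow> 'a" where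
  "outputs A L E t = A L (map E [0..<Suc t])"

definition generator :: "'a gen \<Rightarrow> bool" where
  "generator A \<longleftrightarrow>
    (\<forall>L. collection L \<longrightarrow> (\<forall>K \<in> range L. \<forall>E \<in> enumerations K. \<forall>t.
       outputs A L E t \<notin> outputs A L E ` {..<t} \<and> outputs A L E t \<notin> E ` {..t}))"

definition eventually_consistent :: "'a gen \<Rightarrow> bool" where
  "eventually_consistent A \<longleftrightarrow>
    (\<forall>L. collection L \<longrightarrow> (\<forall>K \<in> range L. \<forall>E \<in> enumerations K.
       \<exists>T. \<forall>t \<ge> T. outputs A L E t \<in> K))"

text \<open>
  Here \<open>i\<close>, \<open>j\<close> and the argument of \<open>D\<close> are counted from 1: \<open>R (j - 1)\<close> is \<open>r\<^sub>j\<close>, and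
  \<open>S ` {..<n}\<close> is the set of the first \<open>n\<close> terms of \<open>S\<close>. The value at \<open>i = 0\<close> is
  irrelevant to the limit superior.
\<close>

definition partial_density :: "nat \<Rightarrow> (nat \<Rightarrow> 'a) \<Rightarrow> (nat \<Rightarrow> 'a) \<Rightarrow> (nat \<Rightarrow> nat) \<Rightarrow> real" where
  "partial_density i S R D = (1 / real i) * (\<Sum>j=1..i. of_bool (R (j - 1) \<in> S ` {..<D j}))"

definition upper_density :: "(nat \<Rightarrow> 'a) \<Rightarrow> 'a gen \<Rightarrow> (nat \<Rightarrow> nat) \<Rightarrow> ereal" where
  "upper_density u A D =
    (INF L \<in> {L. collection L}. INF K \<in> range L. INF E \<in> enumerations K.
       limsup (\<lambda>i. ereal (partial_density i (outputs A L E) (listing u K) D)))"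

end

theory Submission
  imports Defs "HOL-Library.Discrete_Functions"
begin

text \<open>
  An index is critical for a sample if its language contains the sample and is strictly contained
  in every earlier language that does. The least index \<open>z\<close> of the true language is eventually
  critical, and every critical index above \<open>z\<close> then has a smaller language. Time is cut into the
  blocks \<open>[k!, (k+1)!)\<close>. Throughout block \<open>k\<close> the generator commits to the largest index below \<open>k\<close>
  that was critical both at the start of the block and at the start of the previous one, and
  outputs greedily from that language. The guess is eventually at least \<open>z\<close>, which gives
  consistency, and it equals \<open>z\<close> in infinitely many blocks. In such a block everything earlier is
  negligible, and the generator gets at least as many elements as the enumeration reveals.
  Conversely, against any generator, revealing at almost every step the first element neither
  revealed nor output leaves the generator at most half of the elements.
\<close>

section \<open>Critical languages\<close>

definition critical :: "(nat \<Rightarrow> 'a set) \<Rightarrow> 'a set \<Rightarrow> nat \<Rightarrow> bool" where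
  "critical L X n \<longleftrightarrow> X \<subseteq> L n \<and> (\<forall>m<n. X \<subseteq> L m \<longrightarrow> L n \<subset> L m)"

lemma critical_mono:
  assumes "critical L X n" "X \<subseteq> Y" "Y \<subseteq> L n"
  shows "critical L Y n"
  using assms unfolding critical_def by blast

lemma critical_antimono:
  assumes "critical L X m" "critical L X n" "m \<le> n"
  shows "L n \<subseteq> L m"
proof (cases "m = n")
  case False
  then have "L n \<subset> L m"
    using assms unfolding critical_def by force
  then show ?thesis by blast
qed simp

text \<open>Demanding criticality at stage \<open>k - 1\<close> too makes a guess comparable with
  indices critical one stage earlier. The inserted \<open>0\<close> keeps the set nonempty.\<close>

definition guess :: "(nat \<Rightarrow> 'a set) \<Rightarrow> (nat \<Rightarrow> 'a set) \<Rightarrow> nat \<Rightarrow> nat" where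
  "guess L X k = Max (insert 0 {n. n < k \<and> critical L (X (k - 1)) n \<and> critical L (X k) n})"

lemma guess_ge:
  assumes "z < k" "critical L (X (k - 1)) z" "critical L (X k) z"
  shows "z \<le> guess L X k"
  unfolding guess_def using assms by (intro Max_ge) auto

lemma guess_critical:
  assumes "guess L X k \<noteq> 0"
  shows "critical L (X (k - 1)) (guess L X k) \<and> critical L (X k) (guess L X k)"
proof -
  have "guess L X k \<in> insert 0 {n. n < k \<and> critical L (X (k - 1)) n \<and> critical L (X k) n}"
    unfolding guess_def by (rule Max_in) auto
  then show ?thesis
    using assms by auto
qed

context
  fixes L :: "nat \<Rightarrow> 'a set" and X :: "nat \<Rightarrow> 'a set" and z :: nat
  assumes mono_X: "mono X" and Union_X: "(\<Union>k. X k) = L z"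
    and least: "\<And>m. m < z \<Longrightarrow> L m \<noteq> L z"
begin

text \<open>Of the finitely many languages before \<open>z\<close>, those not containing
  \<open>L z\<close> are eventually refuted by the sample; the others are strictly larger because
  \<open>z\<close> is the least index of its language.\<close>

lemma eventually_critical: "\<exists>k0. \<forall>k\<ge>k0. critical L (X k) z"
proof -
  have "\<forall>\<^sub>F k in sequentially. X k \<subseteq> L m \<longrightarrow> L z \<subseteq> L m" for m
  proof (cases "L z \<subseteq> L m")
    case False
    then obtain k where "\<not> X k \<subseteq> L m"
      using Union_X by blast
    then have "\<not> X k' \<subseteq> L m" if "k' \<ge> k" for k'
      using monoD[OF mono_X that] by blast
    then show ?thesis
      unfolding eventually_sequentially by blast
  qed simp
  then have "\<forall>\<^sub>F k in sequentially. \<forall>m\<in>{..<z}. X k \<subseteq> L m \<longrightarrow> L z \<subseteq> L m"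
    by (intro eventually_ball_finite) auto
  then obtain k0 where k0: "\<And>k m. k \<ge> k0 \<Longrightarrow> m < z \<Longrightarrow> X k \<subseteq> L m \<Longrightarrow> L z \<subseteq> L m"
    unfolding eventually_sequentially by blast
  have "critical L (X k) z" if "k \<ge> k0" for k
    unfolding critical_def
  proof (intro conjI allI impI)
    show "X k \<subseteq> L z"
      using Union_X by blast
    show "L z \<subset> L m" if "m < z" "X k \<subseteq> L m" for m
      using k0[OF \<open>k \<ge> k0\<close> that] least[OF that(1)] by (simp add: psubset_eq)
  qed
  then show ?thesis by blast
qed

lemma guess_eventually_subset: "\<exists>k0. \<forall>k\<ge>k0. z \<le> guess L X k \<and> L (guess L X k) \<subseteq> L z"
proof -
  obtain k0 where k0: "\<And>k. k \<ge> k0 \<Longrightarrow> critical L (X k) z"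
    using eventually_critical by blast
  have "z \<le> guess L X k \<and> L (guess L X k) \<subseteq> L z" if "k \<ge> Suc (k0 + z)" for k
  proof -
    have z: "z \<le> guess L X k"
      using that by (intro guess_ge k0) auto
    moreover have "L (guess L X k) \<subseteq> L z"
    \<comment> \<open>The guess \<open>0\<close> may be the default rather than critical, but then
      \<open>z \<le> 0\<close> makes both languages equal.\<close>
    proof (cases "guess L X k = 0")
      case False
      then show ?thesis
        using guess_critical[OF False] k0[of k] that z by (intro critical_antimono) auto
    qed (use z in auto)
    ultimately show ?thesis ..
  qed
  then show ?thesis by blast
qed

text \<open>
  When the least critical index above \<open>z\<close> becomes inconsistent, so does every larger index
  that was critical at the same time, and the guess falls back to \<open>z\<close>. Otherwise that index
  would survive forever, although its language is strictly smaller than \<open>L z\<close>.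
\<close>

lemma guess_infinitely_often: "\<exists>k\<ge>k0. guess L X k = z"
proof (rule ccontr)
  assume never: "\<not> (\<exists>k\<ge>k0. guess L X k = z)"
  obtain k1 where k1: "\<And>k. k \<ge> k1 \<Longrightarrow> z \<le> guess L X k"
    using guess_eventually_subset by blast
  define c where "c = max k0 k1"
  define P where "P m \<longleftrightarrow> m > z \<and> (\<exists>k\<ge>c. critical L (X k) m)" for m
  have above: "guess L X k > z" if "k \<ge> c" for k
    using never k1[of k] that by (force simp: c_def)
  have crit: "critical L (X (k - 1)) (guess L X k) \<and> critical L (X k) (guess L X k)" if "k \<ge> c" for k
    using guess_critical above[OF that] by (metis not_less0)
  have "P (guess L X c)"
    unfolding P_def using above[of c] crit[of c] by blast
  define m where "m = Least P"
  have "P m"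
    unfolding m_def by (rule LeastI) fact
  then obtain k where m: "m > z" "k \<ge> c" "critical L (X k) m"
    unfolding P_def by blast
  have forever: "critical L (X k') m" if "k' \<ge> k" for k'
    using that
  proof (induction k' rule: dec_induct)
    case base
    then show ?case by (rule m)
  next
    case (step n)
    let ?g = "guess L X (Suc n)"
    have g: "critical L (X n) ?g" "critical L (X (Suc n)) ?g" "z < ?g"
      using crit[of "Suc n"] above[of "Suc n"] step m by auto
    then have "P ?g"
      unfolding P_def using step m by (meson le_trans)
    then have "m \<le> ?g"
      unfolding m_def by (rule Least_le)
    \<comment> \<open>Both \<open>m\<close> and \<open>?g\<close> are critical at stage
      \<open>n\<close>, so their languages are nested; since \<open>?g\<close> is still consistent
      at stage \<open>Suc n\<close>, so is \<open>m\<close>.\<close>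
    then have "L ?g \<subseteq> L m"
      using critical_antimono step.IH g(1) by blast
    then have "X (Suc n) \<subseteq> L m"
      using g(2) unfolding critical_def by blast
    then show ?case
      using critical_mono[OF step.IH] monoD[OF mono_X, of n "Suc n"] by simp
  qed
  have "X k' \<subseteq> L m" for k'
    using forever[of "max k k'"] monoD[OF mono_X, of k' "max k k'"] unfolding critical_def by auto
  then have "L z \<subseteq> L m"
    using Union_X by blast
  moreover have "L m \<subset> L z"
    using m Union_X unfolding critical_def by blast
  ultimately show False by blast
qed

end

section \<open>The generator\<close>

definition block :: "nat \<Rightarrow> nat" where
  "block l = (LEAST k. l < fact (Suc k))"

lemma block_eq:
  assumes "fact k \<le> l" "l < fact (Suc k)"
  shows "block l = k"
  unfolding block_def
proof (rule Least_equality)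
  show "l < fact (Suc k)" by (fact assms(2))
next
  fix k' assume "l < fact (Suc k')"
  with assms(1) have "(fact k :: nat) < fact (Suc k')"
    by (rule le_less_trans)
  then have "k < Suc k'"
    by (metis fact_mono_nat not_le)
  then show "k \<le> k'" by simp
qed

lemma block_ge:
  assumes "fact k \<le> l"
  shows "k \<le> block l" "fact (block l) \<le> l"
proof -
  have "l < fact (Suc l)"
    using fact_ge_self[of "Suc l"] by simp
  then have l: "l < fact (Suc (block l))"
    unfolding block_def by (rule LeastI)
  show "k \<le> block l"
    using assms l by (metis fact_mono_nat le_trans not_less not_less_eq_eq)
  show "fact (block l) \<le> l"
  proof (cases "block l")
    case 0
    then show ?thesis
      using order.trans[OF fact_ge_1 assms] by simp
  next
    case (Suc k')
    then have "\<not> l < fact (Suc k')"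
      unfolding block_def by (metis lessI not_less_Least)
    then show ?thesis using Suc by simp
  qed
qed

text \<open>Only prefixes of factorial length enter, so the guess stays constant throughout a
  block.\<close>

definition guessed_language :: "(nat \<Rightarrow> 'a set) \<Rightarrow> 'a list \<Rightarrow> 'a set" where
  "guessed_language L xs = L (guess L (\<lambda>k. set (take (fact k) xs)) (block (length xs)))"

text \<open>
  The listing is searched from position \<open>length xs - 1\<close> on, because an earlier element of the
  listing would be output too late to count.
\<close>

function greedy :: "(nat \<Rightarrow> 'a) \<Rightarrow> 'a gen" where
  "greedy u L xs =
    (let r = listing u (guessed_language L xs)
     in r (LEAST j. length xs - 1 \<le> j \<and>
          r j \<notin> set xs \<union> (\<lambda>k. greedy u L (take (Suc k) xs)) ` {..<length xs - 1}))"
  by pat_completeness auto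
termination
  by (relation "measure (\<lambda>(u, L, xs). length xs)") auto

declare greedy.simps [simp del]

lemma
  assumes "bij u" "infinite K"
  shows inj_listing: "inj (listing u K)" and listing_mem: "listing u K i \<in> K"
proof -
  have inf: "infinite (u -` K)"
    using assms by (metis bij_betw_def finite_imageI surj_image_vimage_eq)
  show "inj (listing u K)"
    unfolding listing_def
    using inj_compose[OF bij_is_inj[OF assms(1)] strict_mono_imp_inj_on[OF strict_mono_enumerate[OF inf]]]
    by (simp add: o_def)
  show "listing u K i \<in> K"
    using enumerate_in_set[OF inf] unfolding listing_def by blast
qed

lemma inj_avoids_finite:
  fixes r :: "nat \<Rightarrow> 'a"
  assumes "inj r" "finite F"
  shows "\<exists>j\<ge>t. r j \<notin> F"
proof -
  have "infinite (r ` {t..})"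
    using assms(1) by (simp add: finite_image_iff inj_on_subset infinite_Ici)
  then have "\<not> r ` {t..} \<subseteq> F"
    using assms(2) finite_subset by blast
  then show ?thesis by auto
qed

text \<open>The recursive calls on prefixes are the earlier outputs of the run, and the sample is
  long enough to contain both stages that the guess inspects. At time \<open>t\<close> it has
  \<open>Suc t\<close> entries, hence the argument of \<open>block\<close>.\<close>

lemma outputs_greedy:
  fixes E :: "nat \<Rightarrow> 'a"
  assumes "bij u" "collection L"
  defines "X \<equiv> \<lambda>k. E ` {..<fact k}"
  defines "o' \<equiv> outputs (greedy u) L E"
  assumes "K = L (guess L X (block (Suc t)))"
  defines "J \<equiv> LEAST j. t \<le> j \<and> listing u K j \<notin> E ` {..t} \<union> o' ` {..<t}"
  shows "o' t = listing u K J" "t \<le> J" "listing u K J \<notin> E ` {..t} \<union> o' ` {..<t}"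
proof -
  let ?xs = "map E [0..<Suc t]"
  have "fact (block (Suc t)) \<le> Suc t"
    using block_ge(2)[of 0 "Suc t"] by simp
  moreover have "(fact (block (Suc t) - 1) :: nat) \<le> fact (block (Suc t))"
    by (intro fact_mono_nat) simp
  ultimately have "set (take (fact k) ?xs) = X k" if "k \<in> {block (Suc t), block (Suc t) - 1}" for k
    using that by (auto simp: X_def take_map atLeast0LessThan min_def simp del: upt_Suc)
  then have "guess L (\<lambda>k. set (take (fact k) ?xs)) (block (Suc t)) = guess L X (block (Suc t))"
    by (simp add: guess_def del: upt_Suc)
  then have K: "guessed_language L ?xs = K"
    using assms(5) by (simp add: guessed_language_def del: upt_Suc)
  have prefixes: "(\<lambda>k. greedy u L (take (Suc k) ?xs)) ` {..<length ?xs - 1} = o' ` {..<t}"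
    unfolding o'_def outputs_def
    by (intro image_cong) (auto simp: take_map min_def simp del: upt_Suc)
  have E: "set ?xs = E ` {..t}"
    by (simp add: atLeast0LessThan lessThan_Suc_atMost del: upt_Suc)
  show "o' t = listing u K J"
    unfolding o'_def outputs_def greedy.simps[of u L ?xs] K prefixes E J_def Let_def
    by (simp add: o'_def)
  have "infinite K"
    using assms(2,5) by (simp add: collection_def language_def)
  then have "\<exists>j\<ge>t. listing u K j \<notin> E ` {..t} \<union> o' ` {..<t}"
    using inj_listing[OF assms(1)] by (intro inj_avoids_finite) auto
  then have "t \<le> J \<and> listing u K J \<notin> E ` {..t} \<union> o' ` {..<t}"
    unfolding J_def by (rule LeastI_ex)
  then show "t \<le> J" "listing u K J \<notin> E ` {..t} \<union> o' ` {..<t}"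
    by auto
qed

lemma generator_greedy:
  assumes "bij u"
  shows "generator (greedy (u :: nat \<Rightarrow> 'a))"
  unfolding generator_def
proof (intro allI impI ballI)
  fix L :: "nat \<Rightarrow> 'a set" and K and E :: "nat \<Rightarrow> 'a" and t
  assume "collection L"
  note out = outputs_greedy[OF assms this refl, where E = E and t = t]
  show "outputs (greedy u) L E t \<notin> outputs (greedy u) L E ` {..<t} \<and> outputs (greedy u) L E t \<notin> E ` {..t}"
    using out(3) unfolding out(1)[symmetric] by blast
qed

section \<open>Eventual consistency\<close>

lemma mono_Union_factorial_blocks:
  fixes E :: "nat \<Rightarrow> 'a"
  defines "X \<equiv> \<lambda>k. E ` {..<fact k}"
  shows "mono X" "(\<Union>k. X k) = range E"
proof -
  show "mono X"
    unfolding X_def by (intro monoI image_mono) (auto intro: order_less_le_trans fact_mono_nat)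
  have "n < fact (Suc n)" for n :: nat
    using fact_ge_self[of "Suc n"] by simp
  then show "(\<Union>k. X k) = range E"
    unfolding X_def by blast
qed

lemma least_index:
  assumes "K \<in> range L"
  obtains z :: nat where "K = L z" "\<And>m. m < z \<Longrightarrow> L m \<noteq> L z"
proof -
  have "\<exists>n. K = L n"
    using assms by blast
  then have "K = L (LEAST n. K = L n)"
    by (rule LeastI_ex)
  moreover have "K \<noteq> L m" if "m < (LEAST n. K = L n)" for m
    using not_less_Least[OF that] .
  ultimately show thesis
    using that by metis
qed

lemma eventually_consistent_greedy:
  assumes "bij u"
  shows "eventually_consistent (greedy u)"
  unfolding eventually_consistent_def
proof (intro allI impI ballI)
  fix L :: "nat \<Rightarrow> 'a set" and K and E :: "nat \<Rightarrow> 'a"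
  assume L: "collection L" and "K \<in> range L" and E: "E \<in> enumerations K"
  obtain z where z: "K = L z" "\<And>m. m < z \<Longrightarrow> L m \<noteq> L z"
    using least_index[OF \<open>K \<in> range L\<close>] by blast
  let ?X = "\<lambda>k. E ` {..<fact k}"
  have Union: "(\<Union>k. ?X k) = L z"
    using mono_Union_factorial_blocks(2)[of E] E z by (simp add: enumerations_def)
  then obtain k0 where k0: "\<And>k. k \<ge> k0 \<Longrightarrow> L (guess L ?X k) \<subseteq> L z"
    using guess_eventually_subset[where X = ?X and L = L and z = z, OF mono_Union_factorial_blocks(1) Union z(2)] by blast
  have "outputs (greedy u) L E t \<in> K" if "t \<ge> fact k0" for t
  proof -
    let ?G = "L (guess L ?X (block (Suc t)))"
    have "infinite ?G"
      using L by (simp add: collection_def language_def)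
    then have "outputs (greedy u) L E t \<in> ?G"
      by (subst outputs_greedy(1)[OF assms L refl]) (rule listing_mem[OF assms])
    then show ?thesis
      using k0[OF block_ge(1)[of k0 "Suc t"]] that z by auto
  qed
  then show "\<exists>T. \<forall>t\<ge>T. outputs (greedy u) L E t \<in> K" by blast
qed

section \<open>Lower bound\<close>

lemma partial_density_eq_card:
  "partial_density i S R (\<lambda>i. i) = real (card {j. j < i \<and> R j \<in> S ` {..j}}) / real i"
proof -
  have "(\<Sum>j=1..i. of_bool (R (j - 1) \<in> S ` {..<j}) :: real) =
      (\<Sum>j<i. of_bool (R j \<in> S ` {..j}))"
    by (rule sum.reindex_bij_witness[of _ Suc "\<lambda>j. j - 1"])
      (auto simp: lessThan_Suc_atMost[symmetric])
  also have "\<dots> = real (card {j. j < i \<and> R j \<in> S ` {..j}})"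
    by (simp add: of_bool_def sum.If_cases Int_def)
  finally show ?thesis
    by (simp add: partial_density_def)
qed

text \<open>
  Up to the first time \<open>s\<close> at which the greedy choice leaves \<open>{..<b}\<close>, each step of the generator
  makes one more element count, while every element of \<open>{a..<b}\<close> that never counts has been
  revealed by time \<open>s\<close>.
\<close>

lemma greedy_count:
  fixes r o' E :: "nat \<Rightarrow> 'a"
  defines "J \<equiv> \<lambda>t. LEAST j. t \<le> j \<and> r j \<notin> E ` {..t} \<union> o' ` {..<t}"
  defines "C b \<equiv> {j. j < b \<and> r j \<in> o' ` {..j}}"
  assumes "inj r"
    and greedy: "\<And>t. a \<le> t \<Longrightarrow> t < b \<Longrightarrow>
      o' t = r (J t) \<and> t \<le> J t \<and> r (J t) \<notin> E ` {..t} \<union> o' ` {..<t}"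
  shows "b \<le> 2 * card (C b) + 2 * a + 1"
proof (cases "a \<le> b")
  case True
  \<comment> \<open>The premise \<open>t < b\<close> makes \<open>b\<close> a witness, so
    \<open>s\<close> exists even if no greedy choice before time \<open>b\<close> leaves
    \<open>{..<b}\<close>.\<close>
  define s where "s = (LEAST t. a \<le> t \<and> (t < b \<longrightarrow> b \<le> J t))"
  have s: "a \<le> s \<and> (s < b \<longrightarrow> b \<le> J s)"
    unfolding s_def by (rule LeastI[of _ b]) (use True in auto)
  have "s \<le> b"
    unfolding s_def by (rule Least_le) (use True in auto)
  have before: "J t < b" if "a \<le> t" "t < s" for t
    using not_less_Least[of t "\<lambda>t. a \<le> t \<and> (t < b \<longrightarrow> b \<le> J t)"] that
    unfolding s_def[symmetric] by auto
  have fin: "finite (C b)"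
    by (simp add: C_def)
  have "o' t \<noteq> o' t'" if "a \<le> t" "t < t'" "t' < s" for t t'
  proof -
    have "o' t' \<notin> o' ` {..<t'}"
      using greedy[of t'] that \<open>s \<le> b\<close> by auto
    moreover have "o' t \<in> o' ` {..<t'}"
      using that by simp
    ultimately show ?thesis by metis
  qed
  then have "inj_on J {a..<s}"
    using greedy \<open>s \<le> b\<close> by (intro linorder_inj_onI) fastforce+
  moreover have "J ` {a..<s} \<subseteq> C b"
  proof
    fix j assume "j \<in> J ` {a..<s}"
    then obtain t where t: "j = J t" "a \<le> t" "t < s" by auto
    then have "o' t = r j" "t \<le> j" "j < b"
      using greedy[of t] before[of t] \<open>s \<le> b\<close> by auto
    then show "j \<in> C b"
      unfolding C_def by (metis (mono_tags, lifting) atMost_iff image_eqI mem_Collect_eq)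
  qed
  ultimately have counted: "s - a \<le> card (C b)"
    using card_inj_on_le[OF _ _ fin] by fastforce
  have "r ` ({a..<b} - C b) \<subseteq> E ` {..s}"
  proof
    fix x assume "x \<in> r ` ({a..<b} - C b)"
    then obtain j where x: "x = r j" and "j \<in> {a..<b} - C b"
      by blast
    then have j: "a \<le> j" "j < b" "r j \<notin> o' ` {..j}"
      by (simp_all add: C_def)
    define t where "t = min j s"
    have t: "a \<le> t" "t < b" "t \<le> j" "t \<le> s"
      using j s by (auto simp: t_def)
    have "r j \<in> E ` {..t} \<union> o' ` {..<t}"
    proof (rule ccontr)
      assume *: "r j \<notin> E ` {..t} \<union> o' ` {..<t}"
      then have "J t \<le> j"
        unfolding J_def using t by (intro Least_le) auto
      show False
      proof (cases "j < s")
        case True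
        then have "J t = j" "t = j"
          using \<open>J t \<le> j\<close> greedy[of t] t by (auto simp: t_def)
        moreover have "o' j \<in> o' ` {..j}" by simp
        ultimately show False
          using greedy[of t] t j by metis
      next
        case False
        then show False
          using s \<open>J t \<le> j\<close> j t by (auto simp: t_def)
      qed
    qed
    moreover have "r j \<notin> o' ` {..<t}"
      using j(3) t(3) by auto
    ultimately show "x \<in> E ` {..s}"
      using t(4) x by auto
  qed
  then have "card (r ` ({a..<b} - C b)) \<le> card (E ` {..s})"
    by (intro card_mono) auto
  also have "\<dots> \<le> Suc s"
    using card_image_le[of "{..s}" E] by simp
  finally have "card ({a..<b} - C b) \<le> Suc s"
    using \<open>inj r\<close> by (simp add: card_image inj_on_subset)
  moreover have "(b - a) - card (C b) \<le> card ({a..<b} - C b)"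
    using diff_card_le_card_Diff[OF fin, of "{a..<b}"] by simp
  \<comment> \<open>The unknown \<open>s\<close> cancels between
    \<open>b - a - card (C b) \<le> Suc s\<close> and \<open>s - a \<le> card (C b)\<close>.\<close>
  ultimately show ?thesis
    using counted by linarith
qed auto

lemma partial_density_greedy:
  assumes "bij u" "collection L" "K \<in> range L" "E \<in> enumerations K"
  shows "\<exists>i\<ge>n. 1/2 - 1 / real (Suc n) \<le> partial_density i (outputs (greedy u) L E) (listing u K) (\<lambda>i. i)"
proof -
  obtain z where z: "K = L z" "\<And>m. m < z \<Longrightarrow> L m \<noteq> L z"
    using least_index[OF assms(3)] by blast
  let ?X = "\<lambda>k. E ` {..<fact k}"
  have Union: "(\<Union>k. ?X k) = L z"
    using mono_Union_factorial_blocks(2)[of E] assms(4) z by (simp add: enumerations_def)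
  then obtain k where k: "k \<ge> Suc n" "guess L ?X k = z"
    using guess_infinitely_often[where X = ?X and L = L and z = z, OF mono_Union_factorial_blocks(1) Union z(2)] by blast
  \<comment> \<open>Time \<open>t\<close> belongs to the block of \<open>Suc t\<close>, so block
    \<open>k\<close> consists of the times in \<open>{a..<b}\<close>.\<close>
  define a b where "a = fact k - (1::nat)" and "b = fact (Suc k) - (1::nat)"
  define C where "C = {j. j < b \<and> listing u K j \<in> outputs (greedy u) L E ` {..j}}"
  have ab: "Suc a = fact k" "Suc b = fact (Suc k)"
    using fact_ge_1[of k, where ?'a = nat] fact_ge_1[of "Suc k", where ?'a = nat]
    unfolding a_def b_def by linarith+
  have "infinite K"
    using assms(2,3) by (auto simp: collection_def language_def)
  have guess_eq: "K = L (guess L ?X (block (Suc t)))" if "a \<le> t" "t < b" for t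
  proof -
    have "block (Suc t) = k"
      using that ab by (intro block_eq) linarith+
    then show ?thesis using k z by simp
  qed
  have count: "b \<le> 2 * card C + 2 * a + 1"
    unfolding C_def
    using outputs_greedy[OF assms(1,2) guess_eq]
    by (intro greedy_count[OF inj_listing[OF assms(1) \<open>infinite K\<close>], where E = E]) blast
  have "Suc b = Suc k * Suc a"
    using ab by simp
  then have b: "b = k * Suc a + a" by simp
  have "k * 1 \<le> k * Suc a"
    by (intro mult_le_mono) auto
  then have "k \<le> b" using b by linarith
  \<comment> \<open>The ratio \<open>Suc k\<close> of consecutive factorials bounds the loss
    \<open>2 * a + 1\<close> by \<open>2 * b / k\<close>, which costs at most \<open>1 / k\<close>
    in density.\<close>
  have "real k * (2 * real a + 1) \<le> 2 * real b"
    unfolding b by (simp add: algebra_simps)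
  moreover have "real b \<le> 2 * real (card C) + 2 * real a + 1"
    using count by linarith
  then have "real k * real b \<le> real k * (2 * real (card C) + 2 * real a + 1)"
    by (rule mult_left_mono) simp
  ultimately have "real k * real b \<le> 2 * real k * real (card C) + 2 * real b"
    by (simp add: algebra_simps)
  then have "1/2 - 1 / real k \<le> real (card C) / real b"
    using \<open>k \<le> b\<close> k(1) by (simp add: field_simps)
  moreover have "1 / real k \<le> 1 / real (Suc n)"
    using k(1) by (intro divide_left_mono) auto
  ultimately show ?thesis
    using \<open>k \<le> b\<close> k(1) unfolding partial_density_eq_card C_def[symmetric]
    by (intro exI[of _ b]) (auto simp: C_def)
qed

lemma upper_density_greedy_ge:
  fixes u :: "nat \<Rightarrow> 'a"
  assumes "bij u"
  shows "ereal (1/2) \<le> upper_density u (greedy u) (\<lambda>i. i)"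
  unfolding upper_density_def
proof (intro INF_greatest, rule ccontr)
  fix L :: "nat \<Rightarrow> 'a set" and K and E :: "nat \<Rightarrow> 'a"
  assume "L \<in> {L. collection L}" "K \<in> range L" "E \<in> enumerations K"
  let ?f = "\<lambda>i. partial_density i (outputs (greedy u) L E) (listing u K) (\<lambda>i. i)"
  assume "\<not> ereal (1/2) \<le> limsup (\<lambda>i. ereal (?f i))"
  then obtain c where c: "limsup (\<lambda>i. ereal (?f i)) < ereal c" "c < 1/2"
    using ereal_dense2[of "limsup (\<lambda>i. ereal (?f i))" "ereal (1/2)"] by (metis less_ereal.simps(1) not_le)
  obtain N where N: "\<And>i. i \<ge> N \<Longrightarrow> ?f i < c"
    using Limsup_lessD[OF c(1)] unfolding eventually_sequentially by auto
  obtain n where n: "1 / real (Suc n) < 1/2 - c"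
    using c(2) nat_approx_posE[of "1/2 - c"] by auto
  have "1 / real (Suc (max n N)) \<le> 1 / real (Suc n)"
    by (intro divide_left_mono) auto
  moreover obtain i where "i \<ge> max n N" "1/2 - 1 / real (Suc (max n N)) \<le> ?f i"
    using partial_density_greedy[OF assms] \<open>L \<in> _\<close> \<open>K \<in> _\<close> \<open>E \<in> _\<close> by blast
  ultimately show False
    using N[of i] n by simp
qed

section \<open>Upper bound\<close>

text \<open>For \<open>t < c\<close> some position below \<open>i\<close> is still untouched:
  otherwise all \<open>c\<close> counted elements would have been output before time
  \<open>t\<close>. Hence the moves outside \<open>Q\<close> before time \<open>c\<close> reveal
  distinct positions below \<open>i\<close> that are never output, and only \<open>i - c\<close>
  positions are uncounted.\<close>

lemma adversary_count:
  fixes u o' E :: "nat \<Rightarrow> 'a" and i :: nat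
  defines "J \<equiv> \<lambda>t. LEAST j. u j \<notin> E ` {..<t} \<union> o' ` {..<t}"
  assumes "inj u"
    and new: "\<And>t. o' t \<notin> o' ` {..<t} \<and> o' t \<notin> E ` {..t}"
    and adversary: "\<And>t. t \<notin> Q \<Longrightarrow> E t = u (J t)"
  defines "c \<equiv> card {j. j < i \<and> u j \<in> o' ` {..j}}"
  shows "2 * c \<le> i + card (Q \<inter> {..<c})"
proof -
  define C where "C = {j. j < i \<and> u j \<in> o' ` {..j}}"
  have c: "c = card C"
    by (simp add: c_def C_def)
  have small: "J t < i" if "t < c" for t
  proof (rule ccontr)
    assume "\<not> J t < i"
    then have covered: "u j \<in> E ` {..<t} \<union> o' ` {..<t}" if "j < i" for j
      unfolding J_def using not_less_Least[of j "\<lambda>j. u j \<notin> E ` {..<t} \<union> o' ` {..<t}"] that by force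
    have "u ` C \<subseteq> o' ` {..<t}"
    proof
      fix x assume "x \<in> u ` C"
      then obtain j s where j: "x = u j" "j < i" "u j = o' s"
        by (auto simp: C_def)
      have "s < t"
      proof (rule ccontr)
        assume "\<not> s < t"
        then show False
          using covered[OF j(2)] new[of s] unfolding j(3) by force
      qed
      then show "x \<in> o' ` {..<t}" using j by auto
    qed
    then have "card (u ` C) \<le> card (o' ` {..<t})"
      by (intro card_mono) auto
    also have "\<dots> \<le> t"
      using card_image_le[of "{..<t}" o'] by simp
    finally show False
      using that \<open>inj u\<close> by (simp add: c card_image inj_on_subset)
  qed
  have fresh: "u (J t) \<notin> E ` {..<t} \<union> o' ` {..<t}" for t
    unfolding J_def
  proof (rule LeastI_ex)
    show "\<exists>j. u j \<notin> E ` {..<t} \<union> o' ` {..<t}"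
      using inj_avoids_finite[OF \<open>inj u\<close>, of "E ` {..<t} \<union> o' ` {..<t}" 0] by auto
  qed
  have "inj_on J ({..<c} - Q)"
  proof (rule linorder_inj_onI)
    fix s t assume "s < t" "s \<in> {..<c} - Q"
    then show "J s \<noteq> J t"
      using fresh[of t] adversary[of s] by (metis DiffD2 UnI1 image_eqI lessThan_iff)
  qed auto
  moreover have "J ` ({..<c} - Q) \<subseteq> {..<i} - C"
  proof
    fix j assume "j \<in> J ` ({..<c} - Q)"
    then obtain t where t: "j = J t" "t < c" "t \<notin> Q" by auto
    \<comment> \<open>Freshness excludes outputs before time \<open>t\<close>; from time
      \<open>t\<close> on, outputs avoid the revealed sample.\<close>
    have "u j \<noteq> o' s" for s
    proof (cases "s < t")
      case True
      then show ?thesis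
        using fresh[of t] t by force
    next
      case False
      then have "E t \<in> E ` {..s}" by simp
      then show ?thesis
        using new[of s] adversary[of t] t by metis
    qed
    then show "j \<in> {..<i} - C"
      using small t by (auto simp: C_def)
  qed
  ultimately have "card ({..<c} - Q) \<le> card ({..<i} - C)"
    by (intro card_inj_on_le) auto
  also have "\<dots> = i - c"
    unfolding c by (subst card_Diff_subset) (auto simp: C_def)
  finally have "card ({..<c} - Q) \<le> i - c" .
  moreover have "card ({..<c} - Q) = c - card (Q \<inter> {..<c})"
    by (simp add: card_Diff_subset_Int Int_commute)
  moreover have "c \<le> i"
    unfolding c using card_mono[of "{..<i}" C] by (auto simp: C_def)
  ultimately show ?thesis by linarith
qed

text \<open>
  An enumeration must also reveal the elements that the generator has output; doing so only at
  square times costs nothing asymptotically.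
\<close>

function adversary :: "(nat \<Rightarrow> 'a) \<Rightarrow> 'a gen \<Rightarrow> nat \<Rightarrow> 'a" where
  "adversary u A t =
    (if t = (floor_sqrt t)\<^sup>2 then u (floor_sqrt t)
     else u (LEAST j. u j \<notin> adversary u A ` {..<t} \<union>
       (\<lambda>s. A (\<lambda>_. UNIV) (map (adversary u A) [0..<Suc s])) ` {..<t}))"
  by pat_completeness auto
termination
  by (relation "measure (\<lambda>(u, A, t). t)") auto

declare adversary.simps [simp del]

lemma card_squares_less: "card ({t. t = (floor_sqrt t)\<^sup>2} \<inter> {..<c}) \<le> Suc (floor_sqrt c)"
proof -
  have "{t. t = (floor_sqrt t)\<^sup>2} \<inter> {..<c} \<subseteq> (\<lambda>k. k\<^sup>2) ` {..floor_sqrt c}"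
    by (auto intro!: image_eqI mono_floor_sqrt')
  then have "card ({t. t = (floor_sqrt t)\<^sup>2} \<inter> {..<c}) \<le> card ((\<lambda>k. k\<^sup>2) ` {..floor_sqrt c})"
    by (intro card_mono) auto
  also have "\<dots> \<le> Suc (floor_sqrt c)"
    using card_image_le[of "{..floor_sqrt c}" "\<lambda>k. k\<^sup>2"] by simp
  finally show ?thesis .
qed

lemma enumerate_UNIV: "enumerate (UNIV :: nat set) n = n"
proof (induction n)
  case 0
  then show ?case
    by (simp add: enumerate_0 Least_eq_0)
next
  case (Suc n)
  then show ?case
    by (subst enumerate_Suc'') (auto intro!: Least_equality)
qed

lemma upper_density_le:
  fixes u :: "nat \<Rightarrow> 'a"
  assumes "bij u" "generator A"
  shows "upper_density u A (\<lambda>i. i) \<le> ereal (1/2)"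
proof -
  \<comment> \<open>With the whole universe as the only language, every enumeration of it is legal
    and the listing is \<open>u\<close> itself.\<close>
  define L where "L = (\<lambda>_::nat. UNIV :: 'a set)"
  define E where "E = adversary u A"
  let ?o = "outputs A L E"
  have "infinite (UNIV :: 'a set)"
    using assms(1) by (metis bij_betw_finite infinite_UNIV_nat)
  then have L: "collection L"
    by (simp add: L_def collection_def language_def)
  have listing: "listing u UNIV = u"
    by (simp add: listing_def fun_eq_iff enumerate_UNIV)
  \<comment> \<open>Time \<open>k\<^sup>2\<close> is reserved for revealing
    \<open>u k\<close>.\<close>
  have "u k \<in> range E" for k
    using adversary.simps[of u A "k\<^sup>2"] unfolding E_def by (auto intro!: image_eqI[of _ _ "k\<^sup>2"])
  then have "range u \<subseteq> range E" by blast
  then have E: "E \<in> enumerations UNIV"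
    using bij_is_surj[OF assms(1)] unfolding enumerations_def by auto
  have bound: "partial_density i ?o u (\<lambda>i. i) \<le> 1/2 + inverse (sqrt (real i))" if "i > 0" for i
  proof -
    define c where "c = card {j. j < i \<and> u j \<in> ?o ` {..j}}"
    have "2 * c \<le> i + card ({t. t = (floor_sqrt t)\<^sup>2} \<inter> {..<c})"
      unfolding c_def
    proof (rule adversary_count[OF bij_is_inj[OF assms(1)]])
      show "?o t \<notin> ?o ` {..<t} \<and> ?o t \<notin> E ` {..t}" for t
        using assms(2) L E unfolding generator_def L_def by blast
      show "E t = u (LEAST j. u j \<notin> E ` {..<t} \<union> ?o ` {..<t})"
        if "t \<notin> {t. t = (floor_sqrt t)\<^sup>2}" for t
        using that adversary.simps[of u A t] unfolding E_def L_def outputs_def by simp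
    qed
    also have "\<dots> \<le> i + Suc (floor_sqrt c)"
      using card_squares_less by simp
    also have "floor_sqrt c \<le> floor_sqrt i"
      using card_mono[of "{..<i}" "{j. j < i \<and> u j \<in> ?o ` {..j}}"]
      by (intro mono_floor_sqrt') (auto simp: c_def)
    finally have "2 * real c \<le> real i + real (floor_sqrt i) + 1" by simp
    also have "real (floor_sqrt i) \<le> sqrt (real i)"
      using floor_sqrt_power2_le[of i] by (intro real_le_rsqrt) (metis of_nat_le_iff of_nat_power)
    \<comment> \<open>Since \<open>i > 0\<close>, the constant \<open>1\<close> is absorbed by a
      second \<open>sqrt (real i)\<close>.\<close>
    finally have "2 * real c \<le> real i + 2 * sqrt (real i)"
      using that by (smt (verit) One_nat_def Suc_leI of_nat_1 of_nat_mono real_sqrt_ge_one)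
    then have "real c / real i \<le> (real i / 2 + sqrt (real i)) / real i"
      by (intro divide_right_mono) auto
    also have "\<dots> = 1/2 + inverse (sqrt (real i))"
      using that by (simp add: add_divide_distrib real_div_sqrt inverse_eq_divide sqrt_divide_self_eq)
    finally show ?thesis
      unfolding partial_density_eq_card c_def[symmetric] .
  qed
  have "upper_density u A (\<lambda>i. i) \<le> limsup (\<lambda>i. ereal (partial_density i ?o u (\<lambda>i. i)))"
    unfolding upper_density_def
    by (intro INF_lower2[of L] INF_lower2[of UNIV] INF_lower2[of E]) (use L E in \<open>auto simp: L_def listing\<close>)
  also have "\<dots> \<le> limsup (\<lambda>i. ereal (1/2 + inverse (sqrt (real i))))"
    using bound by (intro Limsup_mono) (auto simp: eventually_sequentially intro!: exI[of _ 1])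
  also have "\<dots> = ereal (1/2)"
  proof (rule lim_imp_Limsup)
    have "(\<lambda>i. 1/2 + inverse (sqrt (real i))) \<longlonglongrightarrow> 1/2"
      using tendsto_add[OF tendsto_const tendsto_inverse_0_at_top[OF
        filterlim_compose[OF sqrt_at_top filterlim_real_sequentially]], of "1/2"] by simp
    then show "(\<lambda>i. ereal (1/2 + inverse (sqrt (real i)))) \<longlonglongrightarrow> ereal (1/2)"
      by (rule tendsto_ereal)
  qed simp
  finally show ?thesis .
qed

theorem theorem4:
  fixes u :: "nat \<Rightarrow> 'a"
  assumes "bij u"
  shows "\<exists>A. generator A \<and> eventually_consistent A \<and> upper_density u A (\<lambda>i. i) = ereal (1 / 2)"
proof (intro exI conjI)
  show "generator (greedy u)"
    by (rule generator_greedy[OF assms])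
  then show "upper_density u (greedy u) (\<lambda>i. i) = ereal (1 / 2)"
    using upper_density_le[OF assms] upper_density_greedy_ge[OF assms] by (intro antisym)
qed (rule eventually_consistent_greedy[OF assms])

end
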